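(* Let $h:\mathbb{R}^d\to\mathbb{R}$ be locally ACL and continuous, and let $q(z)=\mathcal{N}(z\mid\mu,\Sigma)$ be a multivariate Gaussian distribution with mean $\mu\in\mathbb{R}^d$ and symmetric positive definite covariance matrix $\Sigma\in\mathbb{R}^{d\times d}$. Assume $\mathbb{E}_q[\nabla_zh(z)]$ and $\mathbb{E}_q[\Sigma^{-1}(z-\mu)h(z)]$ are well-defined. Then $$\mathbb{E}_q\big[\Sigma^{-1}(z-\mu)h(z)\big]=\mathbb{E}_q\big[\nabla_zh(z)\big].$$
   Context: An expectation $\mathbb{E}_q[g]$ is called well-defined if $\mathbb{E}_q[\|g\|]<\infty$ (Euclidean norm). A function $g:[a,b]\to\mathbb{R}^m$ is absolutely continuous (AC) if its derivative exists almost everywhere on $[a,b]$, is Lebesgue integrable, and $g(x)=g(a)+\int_a^x g'(t)\,dt$ for all $x\in[a,b]$. A function $g:\mathbb{R}\to\mathbb{R}^m$ is locally AC if it is AC on every compact interval. A function $h:\mathbb{R}^d\to\mathbb{R}^m$ is locally ACL if for every $i$ and almost every $z_{-i}\in\mathbb{R}^{d-1}$ (all coordinates except the $i$-th), the function $z_i\mapsto h(z_i,z_{-i})$ is locally AC. $\nabla_zh$ is the column vector of partial derivatives, existing almost everywhere. *)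

theory Defs
  imports "HOL-Analysis.Analysis"
begin

text \<open>
  Absolute continuity on \<open>[a, b]\<close>. Where \<open>g\<close> is not differentiable, \<^const>\<open>vector_derivative\<close> is an
  arbitrary value; by the first conjunct this happens only on a null set, so it affects neither
  Lebesgue integrability nor the integrals. At the end points the derivative is one-sided.
\<close>

definition AC_on :: "real \<Rightarrow> real \<Rightarrow> (real \<Rightarrow> 'b::euclidean_space) \<Rightarrow> bool" where
  "AC_on a b g \<longleftrightarrow>
     (AE t in lebesgue_on {a..b}. g differentiable (at t within {a..b})) \<and>
     integrable (lebesgue_on {a..b}) (\<lambda>t. vector_derivative g (at t within {a..b})) \<and>
     (\<forall>x\<in>{a..b}. g x = g a +
        (\<integral>t. vector_derivative g (at t within {a..b}) \<partial>(lebesgue_on {a..x})))"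

definition locally_AC :: "(real \<Rightarrow> 'b::euclidean_space) \<Rightarrow> bool" where
  "locally_AC g \<longleftrightarrow> (\<forall>a b. a \<le> b \<longrightarrow> AC_on a b g)"

text \<open>
  The one-variable function \<open>t \<mapsto> h (t, y)\<close> with \<open>t\<close> in coordinate \<open>i\<close> and the remaining
  coordinates taken from \<open>y\<close>; the value \<open>y i\<close> is ignored.
\<close>

definition coord_slice :: "(real^'n \<Rightarrow> 'b) \<Rightarrow> 'n \<Rightarrow> ('n \<Rightarrow> real) \<Rightarrow> real \<Rightarrow> 'b" where
  "coord_slice h i y = (\<lambda>t. h (\<chi> j. if j = i then t else y j))"

text \<open>
  Lebesgue measure on the space of the coordinates other than \<open>i\<close> is the product measure over the
  index set \<open>UNIV - {i}\<close>. In dimension one this is the unit mass on a one-point space, so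
  \<open>locally_ACL\<close> then means \<open>locally_AC\<close>.
\<close>

definition locally_ACL :: "(real^'n \<Rightarrow> 'b::euclidean_space) \<Rightarrow> bool" where
  "locally_ACL h \<longleftrightarrow>
     (\<forall>i. AE y in (\<Pi>\<^sub>M j\<in>UNIV - {i}. (lborel :: real measure)). locally_AC (coord_slice h i y))"

text \<open>
  The vector of partial derivatives, which need not be a Frechet derivative. Components whose
  partial derivative does not exist have an arbitrary value.
\<close>

definition grad :: "(real^'n \<Rightarrow> real) \<Rightarrow> real^'n \<Rightarrow> real^'n" where
  "grad h z = (\<chi> i. deriv (coord_slice h i (\<lambda>j. z $ j)) (z $ i))"

definition sym_pos_def :: "real^'n^'n \<Rightarrow> bool" where
  "sym_pos_def A \<longleftrightarrow> transpose A = A \<and> (\<forall>x. x \<noteq> 0 \<longrightarrow> x \<bullet> (A *v x) > 0)"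

definition mvn_density :: "real^'n \<Rightarrow> real^'n^'n \<Rightarrow> real^'n \<Rightarrow> real" where
  "mvn_density \<mu> \<Sigma> z =
     exp (- ((z - \<mu>) \<bullet> (matrix_inv \<Sigma> *v (z - \<mu>))) / 2) / sqrt ((2 * pi) ^ CARD('n) * det \<Sigma>)"

definition mvn :: "real^'n \<Rightarrow> real^'n^'n \<Rightarrow> (real^'n) measure" where
  "mvn \<mu> \<Sigma> = density lborel (\<lambda>z. ennreal (mvn_density \<mu> \<Sigma> z))"

end

theory Submission
  imports Defs
begin

text \<open>
  Write \<open>p\<close> for the Gaussian density and \<open>s = \<Sigma>\<^sup>-\<^sup>1 (z - \<mu>)\<close>, so that \<open>\<partial>\<^sub>i p = - s\<^sub>i p\<close>. For almost every line
  in direction \<open>i\<close>, both \<open>p \<partial>\<^sub>i h\<close> and \<open>s\<^sub>i h p\<close> are integrable along the line, and \<open>h p\<close> is locally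
  absolutely continuous with derivative \<open>p \<partial>\<^sub>i h - s\<^sub>i h p\<close>. On the line \<open>s\<^sub>i\<close> is an affine function
  with slope \<open>(\<Sigma>\<^sup>-\<^sup>1)\<^sub>i\<^sub>i > 0\<close>, so integrability of \<open>s\<^sub>i h p\<close> forces that of \<open>h p\<close>. An integrable function
  with integrable derivative has no boundary terms at infinity, hence the derivative integrates to
  zero on the line, and Fubini's theorem gives the claim.
\<close>

section \<open>Integration by parts and vanishing boundary terms on the real line\<close>

lemma integration_by_parts_indefinite_integral:
  fixes f g u v :: "real \<Rightarrow> real"
  assumes u: "set_integrable lborel {a..b} u" and v: "set_integrable lborel {a..b} v"
    and g: "\<And>x. x \<in> {a..b} \<Longrightarrow> (LBINT s:{a..x}. u s) = g x - g a"
    and f: "\<And>x. x \<in> {a..b} \<Longrightarrow> (LBINT s:{x..b}. v s) = f b - f x"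
    and "a \<le> b"
  shows "(LBINT x:{a..b}. u x * f x) + (LBINT x:{a..b}. g x * v x) = g b * f b - g a * f a"
proof -
  define U where "U s = indicator {a..b} s * u s" for s
  define V where "V s = indicator {a..b} s * v s" for s
  have U [simp]: "integrable lborel U" and V [simp]: "integrable lborel V"
    using u v by (simp_all add: set_integrable_def U_def [abs_def] V_def [abs_def])
  have [measurable]: "U \<in> borel_measurable borel" "V \<in> borel_measurable borel"
    using borel_measurable_integrable [OF U] borel_measurable_integrable [OF V] by simp_all
  \<comment> \<open>Fubini for \<open>u s * v x\<close> over the triangle \<open>s \<le> x\<close>\<close>
  define K where "K s x = (if s \<le> x then U s * V x else 0)" for s x
  have UV: "integrable (lborel \<Otimes>\<^sub>M lborel) (\<lambda>(s, x). U s * V x)"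
    by (rule lborel_pair.Fubini_integrable) (auto simp: abs_mult)
  have K: "integrable (lborel \<Otimes>\<^sub>M lborel) (\<lambda>(s, x). K s x)"
    by (rule Bochner_Integration.integrable_bound [OF UV]) (auto simp: K_def)
  have inner_s: "(\<integral>s. K s x \<partial>lborel) = V x * g x - V x * g a" for x
  proof (cases "x \<in> {a..b}")
    case True
    then have "(\<lambda>s. K s x) = (\<lambda>s. V x * (indicator {a..x} s * u s))"
      by (auto simp: K_def U_def fun_eq_iff split: split_indicator)
    moreover have "(\<integral>s. indicator {a..x} s * u s \<partial>lborel) = g x - g a"
      using g [OF True] by (simp add: set_lebesgue_integral_def)
    ultimately show ?thesis by (simp add: right_diff_distrib)
  next
    case False
    then have "V x = 0" by (simp add: V_def)
    then show ?thesis by (simp add: K_def cong: if_cong)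
  qed
  have inner_x: "(\<integral>x. K s x \<partial>lborel) = U s * f b - U s * f s" for s
  proof (cases "s \<in> {a..b}")
    case True
    then have "(\<lambda>x. K s x) = (\<lambda>x. U s * (indicator {s..b} x * v x))"
      by (auto simp: K_def V_def fun_eq_iff split: split_indicator)
    moreover have "(\<integral>x. indicator {s..b} x * v x \<partial>lborel) = f b - f s"
      using f [OF True] by (simp add: set_lebesgue_integral_def)
    ultimately show ?thesis by (simp add: right_diff_distrib)
  next
    case False
    then have "U s = 0" by (simp add: U_def)
    then show ?thesis by (simp add: K_def cong: if_cong)
  qed
  \<comment> \<open>Integrability of the products \<open>V x * g x\<close> and
    \<open>U x * f x\<close> is a by-product of Fubini: the partial integrals of \<open>K\<close>
    are integrable and, up to sign, differ from the products by multiples of \<open>V\<close> and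
    \<open>U\<close>.\<close>
  have "integrable lborel (\<lambda>x. V x * g x - V x * g a)"
    using lborel_pair.integrable_snd [OF K] by (simp add: inner_s)
  then have "integrable lborel (\<lambda>x. (V x * g x - V x * g a) + V x * g a)"
    by (rule Bochner_Integration.integrable_add) simp
  then have Vg: "integrable lborel (\<lambda>x. V x * g x)" by simp
  have "integrable lborel (\<lambda>s. U s * f b - U s * f s)"
    using lborel_pair.integrable_fst [OF K] by (simp add: inner_x)
  then have "integrable lborel (\<lambda>s. U s * f b - (U s * f b - U s * f s))"
    by (rule Bochner_Integration.integrable_diff [rotated]) simp
  then have Uf: "integrable lborel (\<lambda>x. U x * f x)" by simp
  have "(\<integral>x. V x * g x - V x * g a \<partial>lborel) = (\<integral>s. U s * f b - U s * f s \<partial>lborel)"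
    using lborel_pair.Fubini_integral [OF K] by (simp add: inner_s inner_x)
  then have "(\<integral>x. V x * g x \<partial>lborel) - (\<integral>x. V x \<partial>lborel) * g a
      = (\<integral>x. U x \<partial>lborel) * f b - (\<integral>x. U x * f x \<partial>lborel)"
    using Vg Uf by simp
  moreover have "(\<integral>x. U x \<partial>lborel) = g b - g a" "(\<integral>x. V x \<partial>lborel) = f b - f a"
    using g [of b] f [of a] \<open>a \<le> b\<close> by (simp_all add: set_lebesgue_integral_def U_def V_def)
  ultimately have "(\<integral>x. U x * f x \<partial>lborel) + (\<integral>x. V x * g x \<partial>lborel) = g b * f b - g a * f a"
    by (simp add: algebra_simps)
  then show ?thesis
    by (simp add: set_lebesgue_integral_def U_def V_def mult_ac)
qed

text \<open>
  The integral of \<open>G\<close> is the limit of \<open>F (t + n) - F (t - n)\<close> for every \<open>t\<close>. By Fatou's lemma,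
  integrating over all \<open>t\<close> bounds \<open>\<infinity>\<close> times its modulus by twice the \<open>L\<^sup>1\<close> norm of \<open>F\<close>.
\<close>

lemma integral_eq_0_if_primitive_integrable:
  fixes F G :: "real \<Rightarrow> real"
  assumes F: "integrable lborel F" and G: "integrable lborel G"
    and FG: "\<And>a b. a \<le> b \<Longrightarrow> F b - F a = (LBINT x:{a..b}. G x)"
  shows "(\<integral>x. G x \<partial>lborel) = 0"
proof -
  let ?L = "\<integral>x. G x \<partial>lborel"
  have [measurable]: "F \<in> borel_measurable borel" "G \<in> borel_measurable borel"
    using F G by (auto dest!: borel_measurable_integrable)
  \<comment> \<open>For fixed \<open>t\<close> the intervals from \<open>t - n\<close> to
    \<open>t + n\<close> exhaust the line, and the modulus of \<open>G\<close> dominates.\<close>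
  have lim: "(\<lambda>n. F (t + real n) - F (t - real n)) \<longlonglongrightarrow> ?L" for t
  proof -
    have "(\<lambda>n. \<integral>x. indicator {t - real n..t + real n} x *\<^sub>R G x \<partial>lborel) \<longlonglongrightarrow> ?L"
    proof (rule integral_dominated_convergence [where w = "\<lambda>x. norm (G x)"])
      show "AE x in lborel. (\<lambda>n. indicator {t - real n..t + real n} x *\<^sub>R G x) \<longlonglongrightarrow> G x"
      proof (rule AE_I2)
        fix x
        have "eventually (\<lambda>n. real n \<ge> \<bar>x - t\<bar>) sequentially"
          using filterlim_real_sequentially by (simp add: filterlim_at_top)
        then have "eventually (\<lambda>n. indicator {t - real n..t + real n} x *\<^sub>R G x = G x) sequentially"
          by eventually_elim (auto split: split_indicator)
        then show "(\<lambda>n. indicator {t - real n..t + real n} x *\<^sub>R G x) \<longlonglongrightarrow> G x"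
          by (rule tendsto_eventually)
      qed
    qed (use G in \<open>auto split: split_indicator\<close>)
    then show ?thesis
      by (simp add: FG set_lebesgue_integral_def)
  qed
  \<comment> \<open>Used for \<open>c = n\<close> and \<open>c = - n\<close>: both halves of the
    difference then contribute the same norm, uniformly in \<open>n\<close>.\<close>
  have shift: "(\<integral>\<^sup>+t. ennreal \<bar>F (c + t)\<bar> \<partial>lborel) = (\<integral>\<^sup>+t. ennreal \<bar>F t\<bar> \<partial>lborel)" for c
    using nn_integral_real_affine [of "\<lambda>t. ennreal \<bar>F t\<bar>" 1 c] by simp
  have fin: "(\<integral>\<^sup>+t. ennreal \<bar>F t\<bar> \<partial>lborel) < \<infinity>"
    using F by (simp add: integrable_iff_bounded)
  have "(\<integral>\<^sup>+t. ennreal \<bar>?L\<bar> \<partial>(lborel :: real measure))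
      = (\<integral>\<^sup>+t. liminf (\<lambda>n. ennreal \<bar>F (t + real n) - F (t - real n)\<bar>) \<partial>lborel)"
  proof (rule nn_integral_cong)
    fix t
    have "(\<lambda>n. ennreal \<bar>F (t + real n) - F (t - real n)\<bar>) \<longlonglongrightarrow> ennreal \<bar>?L\<bar>"
      by (intro tendsto_ennrealI tendsto_rabs lim)
    then show "ennreal \<bar>?L\<bar> = liminf (\<lambda>n. ennreal \<bar>F (t + real n) - F (t - real n)\<bar>)"
      by (simp only: lim_imp_Liminf trivial_limit_sequentially not_False_eq_True)
  qed
  also have "\<dots> \<le> liminf (\<lambda>n. \<integral>\<^sup>+t. ennreal \<bar>F (t + real n) - F (t - real n)\<bar> \<partial>lborel)"
    by (rule nn_integral_liminf) simp
  also have "\<dots> \<le> liminf (\<lambda>n::nat. 2 * (\<integral>\<^sup>+t. ennreal \<bar>F t\<bar> \<partial>lborel))"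
  proof (intro Liminf_mono always_eventually allI)
    fix n
    have "(\<integral>\<^sup>+t. ennreal \<bar>F (t + real n) - F (t - real n)\<bar> \<partial>lborel)
        \<le> (\<integral>\<^sup>+t. ennreal \<bar>F (real n + t)\<bar> + ennreal \<bar>F (- real n + t)\<bar> \<partial>lborel)"
      by (intro nn_integral_mono) (auto simp: add.commute simp flip: ennreal_plus intro!: ennreal_leI)
    also have "\<dots> = 2 * (\<integral>\<^sup>+t. ennreal \<bar>F t\<bar> \<partial>lborel)"
      by (subst nn_integral_add) (simp_all only: shift mult_2, simp_all)
    finally show "(\<integral>\<^sup>+t. ennreal \<bar>F (t + real n) - F (t - real n)\<bar> \<partial>lborel)
        \<le> 2 * (\<integral>\<^sup>+t. ennreal \<bar>F t\<bar> \<partial>lborel)" .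
  qed
  also have "\<dots> < \<infinity>"
    using fin by (simp add: Liminf_const ennreal_mult_less_top)
  finally show ?thesis
    by (auto simp: ennreal_mult_less_top top_unique split: if_splits)
qed

text \<open>The differential equation for \<open>\<phi>\<close> captures the restriction of a
  Gaussian density to a line, whatever its normalisation. The two integrands differ by the
  derivative of \<open>g * \<phi>\<close>, taken in the integrated sense.\<close>

lemma stein_identity_1d:
  fixes g w \<phi> :: "real \<Rightarrow> real"
  assumes \<phi>: "\<And>t. (\<phi> has_real_derivative - (\<alpha> * t + \<beta>) * \<phi> t) (at t)" and "\<alpha> \<noteq> 0"
    and g: "continuous_on UNIV g"
    and w: "\<And>a b. a \<le> b \<Longrightarrow> set_integrable lborel {a..b} w"
    and gw: "\<And>a b. a \<le> b \<Longrightarrow> (LBINT s:{a..b}. w s) = g b - g a"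
    and w\<phi>: "integrable lborel (\<lambda>t. w t * \<phi> t)"
    and g\<phi>: "integrable lborel (\<lambda>t. g t * (\<alpha> * t + \<beta>) * \<phi> t)"
  shows "(\<integral>t. w t * \<phi> t \<partial>lborel) = (\<integral>t. g t * (\<alpha> * t + \<beta>) * \<phi> t \<partial>lborel)"
proof -
  have cont_\<phi>: "continuous_on S \<phi>" for S
    using \<phi> by (meson DERIV_isCont continuous_at_imp_continuous_on)
  have cont_g: "continuous_on S g" for S
    using g continuous_on_subset by blast
  define F where "F t = g t * \<phi> t" for t
  have cont_F: "continuous_on S F" for S
    unfolding F_def [abs_def] by (intro continuous_on_mult cont_g cont_\<phi>)
  have [measurable]: "F \<in> borel_measurable borel"
    using cont_F by (rule borel_measurable_continuous_onI)
  \<comment> \<open>The compact interval around the root \<open>- \<beta> / \<alpha>\<close> on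
    which \<open>\<alpha> * t + \<beta>\<close> has modulus at most 1. On \<open>J\<close>
    continuity bounds \<open>F\<close>; off \<open>J\<close> the affine factor exceeds 1 in modulus,
    so \<open>g\<phi>\<close> dominates \<open>F\<close>.\<close>
  define J where "J = cball (- \<beta> / \<alpha>) (1 / \<bar>\<alpha>\<bar>)"
  have F: "integrable lborel F"
  proof (rule Bochner_Integration.integrable_bound)
    show "integrable lborel (\<lambda>t. \<bar>g t * (\<alpha> * t + \<beta>) * \<phi> t\<bar> + \<bar>indicator J t *\<^sub>R F t\<bar>)"
    proof (intro Bochner_Integration.integrable_add integrable_abs g\<phi>)
      show "integrable lborel (\<lambda>t. indicator J t *\<^sub>R F t)"
        using cont_F by (intro borel_integrable_compact) (auto simp: J_def)
    qed
    have "\<bar>F t\<bar> \<le> \<bar>g t * (\<alpha> * t + \<beta>) * \<phi> t\<bar>" if "t \<notin> J" for t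
    proof -
      have "1 < \<bar>\<alpha>\<bar> * \<bar>t + \<beta> / \<alpha>\<bar>"
        using that \<open>\<alpha> \<noteq> 0\<close> by (auto simp: J_def dist_real_def field_simps abs_minus_commute)
      also have "\<dots> = \<bar>\<alpha> * t + \<beta>\<bar>"
        using \<open>\<alpha> \<noteq> 0\<close> by (simp flip: abs_mult add: field_simps)
      finally have "1 * \<bar>F t\<bar> \<le> \<bar>\<alpha> * t + \<beta>\<bar> * \<bar>F t\<bar>"
        by (intro mult_right_mono) auto
      then show ?thesis by (simp add: F_def abs_mult mult_ac)
    qed
    then show "AE t in lborel. norm (F t) \<le> norm (\<bar>g t * (\<alpha> * t + \<beta>) * \<phi> t\<bar> + \<bar>indicator J t *\<^sub>R F t\<bar>)"
      by (intro AE_I2) (auto split: split_indicator)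
  qed simp
  let ?G = "\<lambda>t. w t * \<phi> t - g t * (\<alpha> * t + \<beta>) * \<phi> t"
  have "(\<integral>t. ?G t \<partial>lborel) = 0"
  proof (rule integral_eq_0_if_primitive_integrable [OF F])
    show "integrable lborel ?G" using w\<phi> g\<phi> by simp
    fix a b :: real assume "a \<le> b"
    let ?v = "\<lambda>t. - (\<alpha> * t + \<beta>) * \<phi> t"
    have cont_v: "continuous_on S ?v" for S
      by (intro continuous_intros cont_\<phi>)
    have D: "(\<phi> has_vector_derivative ?v t) (at t within S)" for t S
      using has_field_derivative_at_within [OF \<phi>]
      by (simp only: has_real_derivative_iff_has_vector_derivative)
    \<comment> \<open>By parts with \<open>w\<close> as the derivative of \<open>g\<close> and
      \<open>?v\<close> as that of \<open>\<phi>\<close>; the minus sign in \<open>?v\<close> makes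
      the sum the integral of \<open>?G\<close>.\<close>
    have "(LBINT t:{a..b}. w t * \<phi> t) + (LBINT t:{a..b}. g t * ?v t) = F b - F a"
      unfolding F_def
    proof (rule integration_by_parts_indefinite_integral)
      show "set_integrable lborel {a..b} ?v"
        by (intro borel_integrable_atLeastAtMost' cont_v)
      show "(LBINT t:{x..b}. ?v t) = \<phi> b - \<phi> x" if "x \<in> {a..b}" for x
        using that unfolding set_lebesgue_integral_def
        by (intro integral_FTC_atLeastAtMost cont_v D) simp
    qed (use \<open>a \<le> b\<close> w gw in auto)
    moreover have "(LBINT t:{a..b}. ?G t) = (LBINT t:{a..b}. w t * \<phi> t) + (LBINT t:{a..b}. g t * ?v t)"
    proof (subst set_integral_add(2) [symmetric])
      show "set_integrable lborel {a..b} (\<lambda>t. w t * \<phi> t)"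
        unfolding set_integrable_def using w\<phi> by (intro integrable_mult_indicator) auto
      show "set_integrable lborel {a..b} (\<lambda>t. g t * ?v t)"
        by (intro borel_integrable_atLeastAtMost' continuous_on_mult cont_v cont_g)
    qed (simp add: algebra_simps)
    ultimately show "F b - F a = (LBINT t:{a..b}. ?G t)" by simp
  qed
  then show ?thesis using w\<phi> g\<phi> by simp
qed

section \<open>Disintegration of Lebesgue measure along coordinate lines\<close>

text \<open>Takes a pair, so that it is a map on the product measure space and \<open>distr\<close>
  can push the product measure forward along it.\<close>

definition coord_insert :: "'n \<Rightarrow> ('n \<Rightarrow> real) \<times> real \<Rightarrow> real^'n" where
  "coord_insert i = (\<lambda>(y, t). \<chi> j. if j = i then t else y j)"

lemma coord_insert_nth [simp]: "coord_insert i (y, t) $ j = (if j = i then t else y j)"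
  by (simp add: coord_insert_def)

lemma coord_slice_eq: "coord_slice h i y t = h (coord_insert i (y, t))"
  by (simp add: coord_slice_def coord_insert_def)

lemma coord_insert_eq: "coord_insert i (y, t) = coord_insert i (y, 0) + t *\<^sub>R axis i 1"
  by (simp add: vec_eq_iff axis_def)

lemma continuous_coord_insert: "continuous_on S (\<lambda>t. coord_insert i (y, t))"
  by (subst coord_insert_eq) (intro continuous_intros)

text \<open>All points of a line in direction \<open>i\<close> have the same slice, since
  \<open>coord_slice\<close> overwrites coordinate \<open>i\<close>. Hence one function of
  \<open>t\<close> gives the partial derivative along the whole line.\<close>

lemma grad_coord_insert: "grad h (coord_insert i (y, t)) $ i = deriv (coord_slice h i y) t"
  unfolding grad_def coord_slice_def by (simp cong: if_cong)

lemma measurable_coord_insert [measurable]: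
  "coord_insert i \<in> (\<Pi>\<^sub>M j\<in>UNIV - {i}. (lborel :: real measure)) \<Otimes>\<^sub>M lborel \<rightarrow>\<^sub>M borel"
proof -
  have "(\<lambda>x. coord_insert i x \<bullet> b) \<in> borel_measurable
      ((\<Pi>\<^sub>M j\<in>UNIV - {i}. (lborel :: real measure)) \<Otimes>\<^sub>M lborel)" if "b \<in> Basis" for b
  proof -
    from that obtain j where b: "b = axis j 1" by (auto simp: Basis_vec_def)
    show ?thesis
    proof (cases "j = i")
      case True
      then show ?thesis by (simp add: b inner_axis coord_insert_def case_prod_beta)
    next
      case False
      then have "j \<in> UNIV - {i}" by simp
      then show ?thesis using False
        by (simp add: b inner_axis coord_insert_def case_prod_beta)
    qed
  qed
  then show ?thesis by (subst borel_measurable_euclidean_space) auto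
qed

text \<open>Lebesgue measure is determined by its values on open boxes, and the preimage of a box is
  the product of a box in the other coordinates and an interval.\<close>

lemma distr_coord_insert:
  "distr ((\<Pi>\<^sub>M j\<in>UNIV - {i}. (lborel :: real measure)) \<Otimes>\<^sub>M lborel) borel (coord_insert i) = lborel"
proof (rule lborel_eqI [symmetric])
  interpret product_sigma_finite "\<lambda>_::'a. lborel :: real measure" ..
  interpret P: finite_product_sigma_finite "\<lambda>_::'a. lborel :: real measure" "UNIV - {i}"
    by standard simp
  fix l u :: "real^'a"
  assume "\<And>b. b \<in> Basis \<Longrightarrow> l \<bullet> b \<le> u \<bullet> b"
  then have le: "l $ j \<le> u $ j" for j
    by (force simp: Basis_vec_def inner_axis)
  let ?P = "\<Pi>\<^sub>M j\<in>UNIV - {i}. (lborel :: real measure)"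
  have all: "(\<forall>j. P j) \<longleftrightarrow> (\<forall>j\<in>UNIV - {i}. P j) \<and> P i" for P :: "'a \<Rightarrow> bool"
    by blast
  have box: "coord_insert i (y, t) \<in> box l u
      \<longleftrightarrow> (\<forall>j\<in>UNIV - {i}. l $ j < y j \<and> y j < u $ j) \<and> l $ i < t \<and> t < u $ i" for y t
    unfolding mem_box_cart by (subst all) auto
  \<comment> \<open>Points of the product space are \<open>undefined\<close> at \<open>i\<close>;
    intersecting with the space supplies this extensionality, which \<open>PiE\<close>
    demands.\<close>
  have "coord_insert i -` box l u \<inter> space (?P \<Otimes>\<^sub>M lborel)
      = (\<Pi>\<^sub>E j\<in>UNIV - {i}. {l $ j<..<u $ j}) \<times> {l $ i<..<u $ i}"
    unfolding set_eq_iff split_paired_All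
    by (simp add: box space_pair_measure space_PiM PiE_iff) blast
  then have "emeasure (distr (?P \<Otimes>\<^sub>M lborel) borel (coord_insert i)) (box l u)
      = emeasure (?P \<Otimes>\<^sub>M lborel) ((\<Pi>\<^sub>E j\<in>UNIV - {i}. {l $ j<..<u $ j}) \<times> {l $ i<..<u $ i})"
    by (simp add: emeasure_distr)
  also have "\<dots> = (\<Prod>j\<in>UNIV - {i}. ennreal (u $ j - l $ j)) * ennreal (u $ i - l $ i)"
    by (subst lborel.emeasure_pair_measure_Times)
       (auto simp: P.measure_times le intro!: sets_PiM_I_finite)
  also have "\<dots> = (\<Prod>j\<in>UNIV. ennreal (u $ j - l $ j))"
    by (subst (2) prod.remove [of _ i]) (simp_all add: mult.commute)
  also have "\<dots> = (\<Prod>b\<in>Basis. (u - l) \<bullet> b)"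
  proof -
    have "(\<Prod>b\<in>Basis. (u - l) \<bullet> b) = (\<Prod>j\<in>UNIV. (u - l) \<bullet> axis j 1)"
      unfolding Basis_vec_def
      by (subst prod.UNION_disjoint) (auto simp: axis_eq_axis)
    then show ?thesis by (simp add: inner_axis prod_ennreal le)
  qed
  finally show "emeasure (distr (?P \<Otimes>\<^sub>M lborel) borel (coord_insert i)) (box l u)
      = (\<Prod>b\<in>Basis. (u - l) \<bullet> b)" .
qed simp

text \<open>Fubini's theorem for the product measure, transported along
  \<open>distr_coord_insert\<close>.\<close>

lemma
  fixes f :: "real^'n \<Rightarrow> 'b::{banach, second_countable_topology}"
  assumes f: "integrable lborel f"
  shows AE_integrable_coord_insert:
      "AE y in (\<Pi>\<^sub>M j\<in>UNIV - {i}. (lborel :: real measure)). integrable lborel (\<lambda>t. f (coord_insert i (y, t)))"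
    and integral_coord_insert:
      "(\<integral>y. (\<integral>t. f (coord_insert i (y, t)) \<partial>lborel) \<partial>(\<Pi>\<^sub>M j\<in>UNIV - {i}. (lborel :: real measure)))
        = (\<integral>z. f z \<partial>lborel)"
proof -
  interpret product_sigma_finite "\<lambda>_::'n. lborel :: real measure" ..
  interpret P: finite_product_sigma_finite "\<lambda>_::'n. lborel :: real measure" "UNIV - {i}"
    by standard simp
  interpret pair_sigma_finite "\<Pi>\<^sub>M j\<in>UNIV - {i}. (lborel :: real measure)" "lborel :: real measure" ..
  have [measurable]: "f \<in> borel_measurable borel"
    using f by (auto dest!: borel_measurable_integrable)
  let ?M = "(\<Pi>\<^sub>M j\<in>UNIV - {i}. (lborel :: real measure)) \<Otimes>\<^sub>M lborel"
  have int: "integrable ?M (\<lambda>x. f (coord_insert i x))"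
    using f by (subst (asm) distr_coord_insert [of i, symmetric]) (simp add: integrable_distr_eq)
  show "AE y in (\<Pi>\<^sub>M j\<in>UNIV - {i}. (lborel :: real measure)). integrable lborel (\<lambda>t. f (coord_insert i (y, t)))"
    by (rule AE_integrable_fst' [OF int])
  have "(\<integral>z. f z \<partial>lborel) = (\<integral>x. f (coord_insert i x) \<partial>?M)"
    by (subst distr_coord_insert [of i, symmetric]) (simp add: integral_distr)
  then show "(\<integral>y. (\<integral>t. f (coord_insert i (y, t)) \<partial>lborel) \<partial>(\<Pi>\<^sub>M j\<in>UNIV - {i}. (lborel :: real measure)))
        = (\<integral>z. f z \<partial>lborel)"
    by (simp add: integral_fst' [OF int])
qed

section \<open>Absolutely continuous functions and their two-sided derivatives\<close>

text \<open>\<open>AC_on\<close> speaks of the completed measure and of derivatives within the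
  interval, the line argument of \<open>lborel\<close> and \<open>deriv\<close>. The derivatives
  agree almost everywhere, and Borel measurability of \<open>deriv g\<close> permits the passage
  from the completion to \<open>lborel\<close>.\<close>

lemma
  fixes g :: "real \<Rightarrow> real"
  assumes AC: "AC_on a b g" and "a \<le> b" and [measurable]: "deriv g \<in> borel_measurable borel"
  shows set_integrable_deriv_AC_on: "set_integrable lborel {a..b} (deriv g)"
    and LBINT_deriv_AC_on: "(LBINT t:{a..b}. deriv g t) = g b - g a"
proof -
  let ?d = "\<lambda>t. vector_derivative g (at t within {a..b})"
  have "AE t in lebesgue. t \<in> {a..b} \<longrightarrow> g differentiable (at t within {a..b})"
    using AC by (simp add: AC_on_def AE_restrict_space_iff)
  \<comment> \<open>At the end points the derivative within the interval is one-sided and may differ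
    from \<open>deriv g\<close>.\<close>
  moreover have "AE t in lebesgue. t \<noteq> a" "AE t in lebesgue. t \<noteq> b"
    by (intro AE_completion AE_lborel_singleton)+
  ultimately have ae: "AE t in lebesgue. indicator {a..b} t *\<^sub>R ?d t = indicator {a..b} t *\<^sub>R deriv g t"
  proof eventually_elim
    case (elim t)
    show ?case
    proof (cases "t \<in> {a..b}")
      case True
      with elim have *: "at t within {a..b} = at t"
        by (intro at_within_Icc_at) auto
      with elim True have "g differentiable (at t)" by simp
      then have "(g has_real_derivative deriv g t) (at t)"
        using DERIV_deriv_iff_real_differentiable by blast
      then have "vector_derivative g (at t) = deriv g t"
        by (intro vector_derivative_at) (simp add: has_real_derivative_iff_has_vector_derivative)
      with * show ?thesis by simp
    qed simp
  qed
  have int: "integrable lebesgue (\<lambda>t. indicator {a..b} t *\<^sub>R ?d t)"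
    using AC by (simp add: AC_on_def integrable_restrict_space)
  have m: "(\<lambda>t. indicator {a..b} t *\<^sub>R deriv g t) \<in> borel_measurable lborel" by measurable
  have "integrable lebesgue (\<lambda>t. indicator {a..b} t *\<^sub>R deriv g t)"
    by (rule integrable_cong_AE_imp [OF int]) (use ae m in \<open>auto intro: measurable_completion\<close>)
  then show "set_integrable lborel {a..b} (deriv g)"
    using m by (simp add: set_integrable_def integrable_completion)
  have "g b = g a + (\<integral>t. ?d t \<partial>(lebesgue_on {a..b}))"
    using AC \<open>a \<le> b\<close> unfolding AC_on_def by (metis atLeastAtMost_iff order_refl)
  then have "g b - g a = (\<integral>t. indicator {a..b} t *\<^sub>R ?d t \<partial>lebesgue)"
    by (simp add: integral_restrict_space)
  also have "\<dots> = (\<integral>t. indicator {a..b} t *\<^sub>R deriv g t \<partial>lebesgue)"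
    by (rule integral_cong_AE) (use int ae m in \<open>auto intro: measurable_completion\<close>)
  also have "\<dots> = (LBINT t:{a..b}. deriv g t)"
    using m by (simp add: set_lebesgue_integral_def integral_completion)
  finally show "(LBINT t:{a..b}. deriv g t) = g b - g a" by simp
qed

section \<open>The Gaussian exponent along a line\<close>

text \<open>Definiteness makes the kernel trivial, so \<open>A\<close> is invertible. The quadratic
  form of the inverse at \<open>x\<close> is that of \<open>A\<close> at the preimage of
  \<open>x\<close>, which is nonzero for nonzero \<open>x\<close>.\<close>

lemma sym_pos_def_matrix_inv:
  fixes A :: "real^'n^'n"
  assumes "sym_pos_def A"
  shows "sym_pos_def (matrix_inv A)"
proof -
  have sym: "transpose A = A" and pos: "\<And>x. x \<noteq> 0 \<Longrightarrow> x \<bullet> (A *v x) > 0"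
    using assms by (auto simp: sym_pos_def_def)
  have "\<forall>x. A *v x = 0 \<longrightarrow> x = 0"
    by (metis inner_zero_right less_irrefl pos)
  then have inv: "invertible A"
    by (simp add: invertible_left_inverse matrix_left_invertible_ker)
  then have l: "matrix_inv A ** A = mat 1" and r: "A ** matrix_inv A = mat 1"
    unfolding invertible_def matrix_inv_def by (metis (mono_tags, lifting) someI_ex)+
  \<comment> \<open>Transposing \<open>r\<close> makes the transposed inverse a left inverse of
    \<open>A\<close>; left and right inverses coincide.\<close>
  have "transpose (matrix_inv A) ** A = mat 1"
    by (metis r sym matrix_transpose_mul transpose_mat)
  then have "transpose (matrix_inv A) = matrix_inv A"
    by (metis r matrix_mul_assoc matrix_mul_lid matrix_mul_rid)
  moreover have "x \<bullet> (matrix_inv A *v x) > 0" if "x \<noteq> 0" for x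
  proof -
    have "A *v (matrix_inv A *v x) = x"
      by (simp add: r matrix_vector_mul_assoc)
    then show ?thesis
      using pos [of "matrix_inv A *v x"] that by (metis inner_commute matrix_vector_mult_0_right)
  qed
  ultimately show ?thesis by (simp add: sym_pos_def_def)
qed

text \<open>On the line the quadratic form is a quadratic polynomial in \<open>t\<close>. Symmetry
  merges its cross terms, and their factor 2 cancels the half in the exponent.\<close>

lemma gaussian_line_derivative:
  fixes A :: "real^'n^'n"
  assumes "transpose A = A"
  shows "((\<lambda>t. exp (- ((c + t *\<^sub>R axis i 1) \<bullet> (A *v (c + t *\<^sub>R axis i 1))) / 2)) has_real_derivative
    - ((A *v axis i 1) $ i * t + (A *v c) $ i)
      * exp (- ((c + t *\<^sub>R axis i 1) \<bullet> (A *v (c + t *\<^sub>R axis i 1))) / 2)) (at t)"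
proof -
  let ?e = "axis i 1 :: real^'n"
  have sym: "c \<bullet> (A *v ?e) = (A *v c) $ i"
    using assms by (metis cart_eq_inner_axis dot_lmul_matrix transpose_matrix_vector)
  have quad: "(c + t *\<^sub>R ?e) \<bullet> (A *v (c + t *\<^sub>R ?e))
      = c \<bullet> (A *v c) + 2 * t * (A *v c) $ i + t\<^sup>2 * (A *v ?e) $ i" for t
    by (simp add: matrix_vector_right_distrib matrix_vector_mult_scaleR inner_add_left inner_add_right sym inner_axis' power2_eq_square algebra_simps)
  show ?thesis
    unfolding quad by (auto intro!: derivative_eq_intros simp: field_simps)
qed

section \<open>Reduction to coordinate lines and the vector identity\<close>

text \<open>Stated with explicit weights over \<open>lborel\<close>, so that Fubini along lines
  applies. Borel measurability of \<open>grad h\<close> is inherited by the derivatives of the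
  slices.\<close>

lemma stein_identity_coordinate:
  fixes h :: "real^'n \<Rightarrow> real"
  assumes ACL: "locally_ACL h" and cont: "continuous_on UNIV h" and pd: "sym_pos_def \<Sigma>"
    and [measurable]: "grad h \<in> borel_measurable borel"
    and int_grad: "integrable lborel (\<lambda>z. grad h z $ i * mvn_density \<mu> \<Sigma> z)"
    and int_score: "integrable lborel (\<lambda>z. h z * (matrix_inv \<Sigma> *v (z - \<mu>)) $ i * mvn_density \<mu> \<Sigma> z)"
  shows "(\<integral>z. grad h z $ i * mvn_density \<mu> \<Sigma> z \<partial>lborel)
    = (\<integral>z. h z * (matrix_inv \<Sigma> *v (z - \<mu>)) $ i * mvn_density \<mu> \<Sigma> z \<partial>lborel)"
proof -
  define A where "A = matrix_inv \<Sigma>"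
  have sym: "transpose A = A" and pos: "\<And>x. x \<noteq> 0 \<Longrightarrow> x \<bullet> (A *v x) > 0"
    using sym_pos_def_matrix_inv [OF pd] by (auto simp: sym_pos_def_def A_def)
  let ?e = "axis i 1 :: real^'n"
  let ?p = "mvn_density \<mu> \<Sigma>"
  let ?P = "\<Pi>\<^sub>M j\<in>UNIV - {i}. (lborel :: real measure)"
  define \<alpha> where "\<alpha> = (A *v ?e) $ i"
  have "\<alpha> \<noteq> 0"
    using pos [of ?e] by (simp add: \<alpha>_def inner_axis')
  \<comment> \<open>Working with the difference of the integrands, it suffices that its integral
    vanishes on almost every line.\<close>
  let ?f = "\<lambda>z. grad h z $ i * ?p z - h z * (A *v (z - \<mu>)) $ i * ?p z"
  have "AE y in ?P. (\<integral>t. ?f (coord_insert i (y, t)) \<partial>lborel) = 0"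
    using ACL [unfolded locally_ACL_def, rule_format, of i] AE_integrable_coord_insert [OF int_grad, of i]
      AE_integrable_coord_insert [OF int_score, of i]
  proof eventually_elim
    case (elim y)
    let ?g = "coord_slice h i y"
    define c where "c = coord_insert i (y, 0) - \<mu>"
    define \<beta> where "\<beta> = (A *v c) $ i"
    have line: "coord_insert i (y, t) - \<mu> = c + t *\<^sub>R ?e" for t
      by (subst coord_insert_eq) (simp add: c_def)
    have score: "(A *v (coord_insert i (y, t) - \<mu>)) $ i = \<alpha> * t + \<beta>" for t
      by (simp add: line \<alpha>_def \<beta>_def matrix_vector_right_distrib matrix_vector_mult_scaleR mult.commute)
    have [measurable]: "(\<lambda>t. coord_insert i (y, t)) \<in> borel_measurable borel"
      by (intro borel_measurable_continuous_onI continuous_coord_insert)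
    \<comment> \<open>The slice derivative is a component of \<open>grad h\<close> composed with a
      continuous line.\<close>
    have "(\<lambda>t. grad h (coord_insert i (y, t)) \<bullet> ?e) \<in> borel_measurable borel"
      by measurable
    then have deriv: "deriv ?g \<in> borel_measurable borel"
      by (simp add: grad_coord_insert flip: cart_eq_inner_axis)
    have AC: "AC_on a b ?g" if "a \<le> b" for a b
      using elim(1) that by (simp add: locally_AC_def)
    have "(\<integral>t. deriv ?g t * ?p (coord_insert i (y, t)) \<partial>lborel)
        = (\<integral>t. ?g t * (\<alpha> * t + \<beta>) * ?p (coord_insert i (y, t)) \<partial>lborel)"
    proof (rule stein_identity_1d [where \<alpha> = \<alpha> and \<beta> = \<beta>])
      show "((\<lambda>t. ?p (coord_insert i (y, t))) has_real_derivative
          - (\<alpha> * t + \<beta>) * ?p (coord_insert i (y, t))) (at t)" for t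
        using DERIV_cdivide [OF gaussian_line_derivative [OF sym, of c i t]]
        by (simp add: mvn_density_def line A_def [symmetric] \<alpha>_def \<beta>_def)
      show "continuous_on UNIV ?g"
        unfolding coord_slice_eq [abs_def]
        by (rule continuous_on_compose2 [OF cont continuous_coord_insert]) simp
      show "integrable lborel (\<lambda>t. deriv ?g t * ?p (coord_insert i (y, t)))"
        using elim(2) by (simp add: grad_coord_insert)
      show "integrable lborel (\<lambda>t. ?g t * (\<alpha> * t + \<beta>) * ?p (coord_insert i (y, t)))"
        using elim(3) by (simp add: score coord_slice_eq flip: A_def)
    qed (use \<open>\<alpha> \<noteq> 0\<close> AC deriv set_integrable_deriv_AC_on LBINT_deriv_AC_on in blast)+
    moreover have "integrable lborel (\<lambda>t. deriv ?g t * ?p (coord_insert i (y, t)))"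
      using elim(2) by (simp add: grad_coord_insert)
    moreover have "integrable lborel (\<lambda>t. ?g t * (\<alpha> * t + \<beta>) * ?p (coord_insert i (y, t)))"
      using elim(3) by (simp add: score coord_slice_eq flip: A_def)
    ultimately show ?case
      by (simp add: grad_coord_insert score coord_slice_eq)
  qed
  then have "(\<integral>y. (\<integral>t. ?f (coord_insert i (y, t)) \<partial>lborel) \<partial>?P) = 0"
    by (rule integral_eq_zero_AE)
  moreover have "integrable lborel ?f"
    using int_grad int_score by (simp add: A_def)
  ultimately have "(\<integral>z. ?f z \<partial>lborel) = 0"
    using integral_coord_insert [of ?f i] by simp
  then show ?thesis
    using int_grad int_score by (simp add: A_def)
qed

lemma borel_measurable_mvn_density [measurable]: "mvn_density \<mu> \<Sigma> \<in> borel_measurable borel"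
  unfolding mvn_density_def [abs_def] divide_inverse
  by (intro borel_measurable_continuous_onI continuous_intros
      continuous_on_compose2 [OF matrix_vector_mult_linear_continuous_on [of UNIV]]) auto

theorem lemma5:
  fixes h :: "real^'n \<Rightarrow> real" and \<mu> :: "real^'n" and \<Sigma> :: "real^'n^'n"
  assumes "locally_ACL h"
    and "continuous_on UNIV h"
    and "sym_pos_def \<Sigma>"
    and "integrable (mvn \<mu> \<Sigma>) (grad h)"
    and "integrable (mvn \<mu> \<Sigma>) (\<lambda>z. h z *\<^sub>R (matrix_inv \<Sigma> *v (z - \<mu>)))"
  shows "(\<integral>z. h z *\<^sub>R (matrix_inv \<Sigma> *v (z - \<mu>)) \<partial>(mvn \<mu> \<Sigma>)) = (\<integral>z. grad h z \<partial>(mvn \<mu> \<Sigma>))"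
\<comment> \<open>Integrals over \<open>mvn\<close> unfold to weighted Lebesgue integrals only for a
  nonnegative density. Since \<open>sqrt\<close> is odd and division by zero gives zero, the density
  has the sign of \<open>det \<Sigma>\<close>; the case split stands in for a proof that this
  determinant is positive.\<close>
proof (cases "det \<Sigma> < 0")
  case True
  \<comment> \<open>This case cannot occur, but it is harmless: the density is negative, so \<^const>\<open>ennreal\<close> makes \<^const>\<open>mvn\<close> the null measure.\<close>
  then have "mvn_density \<mu> \<Sigma> z \<le> 0" for z
    by (auto simp: mvn_density_def divide_nonneg_nonpos mult_nonneg_nonpos)
  then have "mvn \<mu> \<Sigma> = density lborel (\<lambda>_. 0)"
    by (simp add: mvn_def ennreal_neg)
  then have AE: "AE z in mvn \<mu> \<Sigma>. P z" for P
    by (simp only:) (subst AE_density; simp)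
  show ?thesis
    by (simp only: integral_eq_zero_AE [OF AE])
next
  case False
  let ?p = "mvn_density \<mu> \<Sigma>" and ?S = "\<lambda>z. h z *\<^sub>R (matrix_inv \<Sigma> *v (z - \<mu>))"
  have p: "?p z \<ge> 0" for z
    using False by (simp add: mvn_density_def)
  have m: "grad h \<in> borel_measurable borel" "?S \<in> borel_measurable borel"
    using assms(4,5) [THEN borel_measurable_integrable] by (simp_all add: mvn_def)
  have int: "integrable lborel (\<lambda>z. ?p z *\<^sub>R grad h z)" "integrable lborel (\<lambda>z. ?p z *\<^sub>R ?S z)"
    using assms(4,5) m p by (simp_all add: mvn_def integrable_density)
  have "(\<integral>z. ?p z *\<^sub>R ?S z \<partial>lborel) \<bullet> axis i 1 = (\<integral>z. ?p z *\<^sub>R grad h z \<partial>lborel) \<bullet> axis i 1" for i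
  proof -
    have "integrable lborel (\<lambda>z. grad h z $ i * ?p z)"
      using integrable_inner_left [OF int(1), of "axis i 1"]
      by (simp add: mult.commute flip: cart_eq_inner_axis)
    moreover have "integrable lborel (\<lambda>z. h z * (matrix_inv \<Sigma> *v (z - \<mu>)) $ i * ?p z)"
      using integrable_inner_left [OF int(2), of "axis i 1"]
      by (simp add: mult_ac flip: cart_eq_inner_axis)
    ultimately have "(\<integral>z. grad h z $ i * ?p z \<partial>lborel)
        = (\<integral>z. h z * (matrix_inv \<Sigma> *v (z - \<mu>)) $ i * ?p z \<partial>lborel)"
      using assms m by (intro stein_identity_coordinate)
    then show ?thesis
      by (simp only: integral_inner_left [OF int(1), symmetric] integral_inner_left [OF int(2), symmetric])
        (simp add: mult_ac flip: cart_eq_inner_axis)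
  qed
  then have "(\<integral>z. ?p z *\<^sub>R ?S z \<partial>lborel) = (\<integral>z. ?p z *\<^sub>R grad h z \<partial>lborel)"
    by (simp add: vec_eq_iff cart_eq_inner_axis)
  then show ?thesis
    using m p by (simp add: mvn_def integral_density)
qed

end
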